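(* Let $d\ge1$, let $\Omega=\mathbb{R}^d$ be endowed with a continuous probability distribution function of the form $\mathbf F(\mathbf z)=F_1(z_1)\cdots F_d(z_d)$, where $F_1,\ldots,F_d$ are marginal distribution functions. Let $f:\Omega\to\mathbb{R}$ be a bounded, square-integrable function with continuous second-order partial derivatives and variance $\sigma^2=\mathrm{Var}(f)>0$ with respect to $\mathbf F$, such that all entries of the matrix $\mathbf C_{\rm gas}$ are well-defined (finite). For any $0<\epsilon<1$, and $a',b'\in\mathbb{R}$ with $a'<b'$ such that $\int_{(a',b')^d}d\mathbf F(\mathbf z)=1-\epsilon$, we have for every $i=1,\ldots,d$ $$\bar S_i\le\frac{(b'-a')^2}{2}\,\frac{\gamma_i(d)+\kappa}{\sigma^2},$$ where $\kappa$ is the positive constant $$\kappa=\frac{2\epsilon-\epsilon^2}{(b'-a')^2}\,\sup_{\mathbf z,\mathbf v\in\Omega}\big(f(\mathbf z)-f(\mathbf v)\big)^2,$$ $\bar S_i$ is the (generalized) upper Sobol' index of the $i$th input and $\gamma_i(d)$ is the global activity score of the $i$th parameter with $m=d$.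
   Context: Notation: for $\mathbf v,\mathbf z\in\mathbb{R}^d$, $(\mathbf v_{\{i\}}{:}\mathbf z_{-\{i\}})$ is the vector whose $i$th component is $v_i$ and whose $j$th component is $z_j$ for $j\ne i$. Generalized upper Sobol' index: $$\bar S_i=\frac{1}{2\sigma^2}\int \big(f(\mathbf z)-f(\mathbf v_{\{i\}}{:}\mathbf z_{-\{i\}})\big)^2\,d\mathbf F(\mathbf z)\,dF_i(v_i),$$ where $\sigma^2$ is the variance of $f(\mathbf z)$ for $\mathbf z\sim\mathbf F$. Global activity scores: let $\mathbf v,\mathbf z$ be independent random vectors, both with distribution $\mathbf F$. Define $$D_{\mathbf z,i}f(v_i,\mathbf z)=\frac{f(\mathbf v_{\{i\}}{:}\mathbf z_{-\{i\}})-f(\mathbf z)}{v_i-z_i},\qquad D_{\mathbf z}f(\mathbf v,\mathbf z)=[D_{\mathbf z,1}f(v_1,\mathbf z),\ldots,D_{\mathbf z,d}f(v_d,\mathbf z)]^T,$$ (defined almost surely), and the $d\times d$ symmetric positive semidefinite matrix $$\mathbf C_{\rm gas}=\mathbb{E}\big[\mathbb{E}[(D_{\mathbf z}f)(D_{\mathbf z}f)^T\mid \mathbf z]\big].$$ Let $\mathbf C_{\rm gas}=\mathbf U\Lambda\mathbf U^T$ be an eigenvalue decomposition, with $\mathbf U=[\mathbf u_1,\ldots,\mathbf u_d]$ orthogonal, $\mathbf u_j=[u_{1j},\ldots,u_{dj}]^T$, and $\Lambda=\mathrm{diag}(\lambda_1,\ldots,\lambda_d)$, $\lambda_1\ge\cdots\ge\lambda_d\ge0$.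 For $m\le d$ the global activity score of the $i$th parameter is $\gamma_i(m)=\sum_{j=1}^m\lambda_j u_{ij}^2$. *)

theory Defs
  imports "HOL-Probability.Probability"
begin

definition distribution_function :: "(real \<Rightarrow> real) \<Rightarrow> bool" where
  "distribution_function G \<longleftrightarrow>
     mono G \<and> (\<forall>x. continuous (at_right x) G) \<and>
     (G \<longlongrightarrow> 0) at_bot \<and> (G \<longlongrightarrow> 1) at_top"

definition joint_cdf :: "('d::finite \<Rightarrow> real \<Rightarrow> real) \<Rightarrow> real^'d \<Rightarrow> real" where
  "joint_cdf F z = (\<Prod>i\<in>UNIV. F i (z $ i))"

(* The probability measure on R^d whose distribution function is joint_cdf F
   (see joint_law_cdf below); the product measure lives on 'd => real and is
   transported to real^'d. *)
definition joint_law :: "('d::finite \<Rightarrow> real \<Rightarrow> real) \<Rightarrow> (real^'d) measure" where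
  "joint_law F = distr (Pi\<^sub>M UNIV (\<lambda>i. interval_measure (F i))) borel (\<lambda>x. \<chi> i. x i)"

lemma sets_joint_law [simp, measurable_cong]: "sets (joint_law F) = sets borel"
  by (simp add: joint_law_def)

lemma space_joint_law [simp]: "space (joint_law F) = UNIV"
  by (simp add: joint_law_def)

lemma real_distribution_marginal:
  "distribution_function G \<Longrightarrow> real_distribution (interval_measure G)"
  unfolding distribution_function_def mono_def
  by (intro real_distribution_interval_measure) auto

lemma vec_lambda_measurable [measurable]:
  fixes F :: "'d::finite \<Rightarrow> real \<Rightarrow> real"
  shows "(\<lambda>x. \<chi> i. x i) \<in> measurable (Pi\<^sub>M UNIV (\<lambda>i. interval_measure (F i))) (borel :: (real^'d) measure)"
proof -
  have "(\<lambda>x. x i) \<in> measurable (Pi\<^sub>M UNIV (\<lambda>i. interval_measure (F i))) borel" for i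
    using measurable_component_singleton[of i UNIV "\<lambda>i. interval_measure (F i)"]
    by (simp cong: measurable_cong_sets)
  then show ?thesis
    by (subst borel_measurable_euclidean_space) (auto simp: Basis_vec_def inner_axis)
qed

lemma prob_space_joint_law:
  assumes "\<And>i. distribution_function (F i)"
  shows "prob_space (joint_law F)"
proof -
  interpret product_prob_space "\<lambda>i. interval_measure (F i)" UNIV
    using real_distribution_marginal[OF assms]
    by (auto simp: product_prob_space_def product_prob_space_axioms_def product_sigma_finite_def
        real_distribution_def intro: prob_space_imp_sigma_finite)
  show ?thesis
    unfolding joint_law_def by (rule prob_space_distr) simp
qed

lemma joint_law_cdf:
  assumes "\<And>i. distribution_function (F i)"
  shows "measure (joint_law F) {x. \<forall>i. x $ i \<le> z $ i} = joint_cdf F z"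
proof -
  interpret product_prob_space "\<lambda>i. interval_measure (F i)" UNIV
    using real_distribution_marginal[OF assms]
    by (auto simp: product_prob_space_def product_prob_space_axioms_def product_sigma_finite_def
        real_distribution_def intro: prob_space_imp_sigma_finite)
  have cl: "{x. \<forall>i. x $ i \<le> z $ i} \<in> sets borel"
    by (intro borel_closed closed_Collect_all closed_Collect_le continuous_intros)
  have "(\<lambda>x. \<chi> i. x i) -` {x. \<forall>i. x $ i \<le> z $ i} \<inter>
          space (Pi\<^sub>M UNIV (\<lambda>i. interval_measure (F i))) = Pi\<^sub>E UNIV (\<lambda>i. {..z $ i})"
    by (auto simp: space_PiM PiE_def Pi_def)
  then have "measure (joint_law F) {x. \<forall>i. x $ i \<le> z $ i} =
      measure (Pi\<^sub>M UNIV (\<lambda>i. interval_measure (F i))) (Pi\<^sub>E UNIV (\<lambda>i. {..z $ i}))"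
    using cl by (simp add: joint_law_def measure_distr)
  also have "\<dots> = (\<Prod>i\<in>UNIV. measure (interval_measure (F i)) {..z $ i})"
    using measure_PiM_emb[of UNIV "\<lambda>i. {..z $ i}"] by (simp add: prod_emb_def space_PiM PiE_def restrict_def)
  also have "\<dots> = joint_cdf F z"
    unfolding joint_cdf_def
  proof (rule prod.cong)
    fix i
    have "cdf (interval_measure (F i)) = F i"
      using assms[of i] unfolding distribution_function_def mono_def
      by (intro cdf_interval_measure) auto
    then show "measure (interval_measure (F i)) {..z $ i} = F i (z $ i)"
      by (simp add: cdf_def2[symmetric])
  qed simp
  finally show ?thesis .
qed

(* replace_coord i (v $ i) z is the vector with i-th component v_i and j-th component z_j, j \<noteq> i. *)
definition replace_coord :: "'d::finite \<Rightarrow> real \<Rightarrow> real^'d \<Rightarrow> real^'d" where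
  "replace_coord i t z = (\<chi> j. if j = i then t else z $ j)"

definition continuous_second_partials :: "(real^'d::finite \<Rightarrow> real) \<Rightarrow> bool" where
  "continuous_second_partials f \<longleftrightarrow>
     (\<exists>f1 f2.
        (\<forall>i x. ((\<lambda>t. f (replace_coord i t x)) has_real_derivative f1 i x) (at (x $ i))) \<and>
        (\<forall>i j x. ((\<lambda>t. f1 i (replace_coord j t x)) has_real_derivative f2 i j x) (at (x $ j))) \<and>
        (\<forall>i j. continuous_on UNIV (f2 i j)))"

definition law_variance :: "(real^'d::finite) measure \<Rightarrow> (real^'d \<Rightarrow> real) \<Rightarrow> real" where
  "law_variance M f = (\<integral>z. (f z - (\<integral>y. f y \<partial>M))\<^sup>2 \<partial>M)"

definition upper_sobol ::
  "('d::finite \<Rightarrow> real \<Rightarrow> real) \<Rightarrow> (real^'d \<Rightarrow> real) \<Rightarrow> 'd \<Rightarrow> real" where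
  "upper_sobol F f i =
     1 / (2 * law_variance (joint_law F) f) *
     (\<integral>p. (f (fst p) - f (replace_coord i (snd p) (fst p)))\<^sup>2
        \<partial>(joint_law F \<Otimes>\<^sub>M interval_measure (F i)))"

(* Only almost surely meaningful: when v_i = z_i the quotient is 0 / 0 = 0. For continuous
   marginals this event is null. *)
definition diff_quotient ::
  "(real^'d::finite \<Rightarrow> real) \<Rightarrow> real^'d \<Rightarrow> real^'d \<Rightarrow> real^'d" where
  "diff_quotient f v z = (\<chi> i. (f (replace_coord i (v $ i) z) - f z) / (v $ i - z $ i))"

(* The random vectors V and Z live on the probability space P; conditioning on Z is
   conditioning on the sigma-algebra generated by Z. *)
definition gas_matrix ::
  "'w measure \<Rightarrow> ('w \<Rightarrow> real^'d::finite) \<Rightarrow> ('w \<Rightarrow> real^'d) \<Rightarrow> (real^'d \<Rightarrow> real) \<Rightarrow> real^'d^'d" where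
  "gas_matrix P V Z f = (\<chi> i j.
     \<integral>w. real_cond_exp P (vimage_algebra (space P) Z borel)
           (\<lambda>w. diff_quotient f (V w) (Z w) $ i * diff_quotient f (V w) (Z w) $ j) w \<partial>P)"

definition gas_matrix_finite ::
  "'w measure \<Rightarrow> ('w \<Rightarrow> real^'d::finite) \<Rightarrow> ('w \<Rightarrow> real^'d) \<Rightarrow> (real^'d \<Rightarrow> real) \<Rightarrow> bool" where
  "gas_matrix_finite P V Z f \<longleftrightarrow>
     (\<forall>i j. integrable P
        (\<lambda>w. diff_quotient f (V w) (Z w) $ i * diff_quotient f (V w) (Z w) $ j))"

definition diag_matrix :: "('d::finite \<Rightarrow> real) \<Rightarrow> real^'d^'d" where
  "diag_matrix l = (\<chi> i j. if i = j then l i else 0)"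

(* The index type 'd carries no order, so e numbers it as 1, ..., d: the j-th eigenvalue is
   l (e j), and the j-th eigenvector is the column of U with index e j. *)
definition eigenvalue_decomposition ::
  "real^'d^'d::finite \<Rightarrow> real^'d^'d \<Rightarrow> ('d \<Rightarrow> real) \<Rightarrow> (nat \<Rightarrow> 'd) \<Rightarrow> bool" where
  "eigenvalue_decomposition C U l e \<longleftrightarrow>
     C = U ** diag_matrix l ** transpose U \<and> orthogonal_matrix U \<and>
     bij_betw e {1..CARD('d)} UNIV \<and>
     (\<forall>j\<in>{1..CARD('d)}. \<forall>k\<in>{1..CARD('d)}. j \<le> k \<longrightarrow> l (e k) \<le> l (e j)) \<and>
     (\<forall>j\<in>{1..CARD('d)}. 0 \<le> l (e j))"

definition activity_score ::
  "real^'d^'d::finite \<Rightarrow> ('d \<Rightarrow> real) \<Rightarrow> (nat \<Rightarrow> 'd) \<Rightarrow> 'd \<Rightarrow> nat \<Rightarrow> real" where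
  "activity_score U l e i m = (\<Sum>j=1..m. l (e j) * (U $ i $ e j)\<^sup>2)"

definition kappa_const :: "real \<Rightarrow> real \<Rightarrow> real \<Rightarrow> (real^'d::finite \<Rightarrow> real) \<Rightarrow> real" where
  "kappa_const \<epsilon> a b f =
     (2 * \<epsilon> - \<epsilon>\<^sup>2) / (b - a)\<^sup>2 * (SUP (z, v) \<in> UNIV. (f z - f v)\<^sup>2)"

end

theory Submission
  imports Defs
begin

text \<open>
  The upper Sobol' index of the \<open>i\<close>th input is, up to the factor \<open>1 / (2 \<sigma>\<^sup>2)\<close>, the mean square of
  the increment \<open>f(z) - f(v\<^sub>i : z\<^sub>-\<^sub>i)\<close>. The proof splits this mean according to whether the independent
  points \<open>V\<close> and \<open>Z\<close> both lie in the cube \<open>(a, b)\<^sup>d\<close>. If they do, then \<open>\<bar>v\<^sub>i - z\<^sub>i\<bar> < b - a\<close>, so the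
  increment is at most \<open>b - a\<close> times the absolute difference quotient. If they do not, the squared
  increment is still at most \<open>sup (f(z) - f(v))\<^sup>2\<close>, and by independence this happens with probability
  \<open>1 - (1 - \<epsilon>)\<^sup>2 = 2 \<epsilon> - \<epsilon>\<^sup>2\<close>. Hence the mean square increment is at most
  \<open>(b - a)\<^sup>2 (E (D\<^sub>i f)\<^sup>2 + \<kappa>)\<close> (\<open>mean_square_increment_le\<close>).

  The remaining ingredient is that \<open>E (D\<^sub>i f)\<^sup>2\<close> is the activity score with all \<open>d\<close> terms: by the tower
  property it is the \<open>i\<close>th diagonal entry of the gas matrix \<open>C\<close> (\<open>gas_matrix_diagonal\<close>), and reading
  \<open>C = U \<Lambda> U\<^sup>T\<close> on the diagonal gives \<open>\<Sum>\<^sub>j \<lambda>\<^sub>j u\<^sub>i\<^sub>j\<^sup>2\<close> (\<open>activity_score_full\<close>).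
\<close>

lemma distr_joint_law_component:
  fixes F :: "'d::finite \<Rightarrow> real \<Rightarrow> real"
  assumes "\<And>i. distribution_function (F i)"
  shows "distr (joint_law F) borel (\<lambda>z. z $ i) = interval_measure (F i)"
proof -
  interpret product_prob_space "\<lambda>i. interval_measure (F i)" UNIV
    using real_distribution_marginal[OF assms]
    by (auto simp: product_prob_space_def product_prob_space_axioms_def product_sigma_finite_def
        real_distribution_def intro: prob_space_imp_sigma_finite)
  let ?P = "Pi\<^sub>M UNIV (\<lambda>i. interval_measure (F i))"
  have "distr (joint_law F) borel (\<lambda>z. z $ i) = distr ?P borel (\<lambda>x. x i)"
    unfolding joint_law_def
    by (subst distr_distr) (auto simp: comp_def)
  also have "\<dots> = distr ?P (interval_measure (F i)) (\<lambda>x. x i)"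
    by (intro distr_cong) auto
  also have "\<dots> = interval_measure (F i)"
    by (rule PiM_component) auto
  finally show ?thesis .
qed

declare borel_measurable_nth [measurable]

lemma borel_measurable_replace_coord [measurable]:
  "(\<lambda>p. replace_coord i (snd p) (fst p)) \<in> borel_measurable (borel \<Otimes>\<^sub>M borel)"
proof -
  have "continuous_on UNIV (\<lambda>p. (\<chi> j. if j = i then snd p else fst p $ j) :: real^'a)"
  proof (rule continuous_on_vec_lambda)
    fix j
    show "continuous_on UNIV (\<lambda>p::(real^'a) \<times> real. if j = i then snd p else fst p $ j)"
      by (cases "j = i") (auto intro!: continuous_intros)
  qed
  then show ?thesis
    unfolding replace_coord_def borel_prod by (rule borel_measurable_continuous_onI)
qed

text \<open>
  This holds also when \<open>v\<^sub>i = z\<^sub>i\<close>, where the quotient takes the default value \<open>0\<close>, because then both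
  points coincide and the increment vanishes. The estimates below therefore hold pointwise, without
  an exceptional null set.
\<close>

lemma increment_eq_diff_quotient:
  "f (replace_coord i (v $ i) z) - f z = diff_quotient f v z $ i * (v $ i - z $ i)"
proof (cases "v $ i = z $ i")
  case True
  then have "replace_coord i (v $ i) z = z"
    by (auto simp: replace_coord_def vec_eq_iff)
  then show ?thesis using True by simp
qed (simp add: diff_quotient_def)

lemma bdd_above_square_increments:
  fixes f :: "'a \<Rightarrow> real"
  assumes "bounded (range f)"
  shows "bdd_above (range (\<lambda>(z, v). (f z - f v)\<^sup>2))"
proof -
  obtain B where B: "\<bar>f x\<bar> \<le> B" for x
    using assms by (auto simp: bounded_iff)
  have "(f z - f v)\<^sup>2 \<le> (2 * B)\<^sup>2" for z v
    using B[of z] B[of v] by (intro power2_le_iff_abs_le[THEN iffD2]) auto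
  then show ?thesis
    by (intro bdd_aboveI[of _ "(2 * B)\<^sup>2"]) auto
qed

lemma square_increment_le_Sup:
  fixes f :: "'a \<Rightarrow> real"
  assumes "bounded (range f)"
  shows "(f z - f v)\<^sup>2 \<le> (SUP (z, v) \<in> UNIV. (f z - f v)\<^sup>2)"
  using cSUP_upper[OF UNIV_I bdd_above_square_increments[OF assms], of "(z, v)"] by simp

text \<open>If the supremum vanished, \<open>f\<close> would be constant and its variance zero.\<close>

lemma Sup_square_increment_pos:
  fixes f :: "real^'d::finite \<Rightarrow> real"
  assumes "bounded (range f)" "prob_space M" "law_variance M f > 0"
  shows "(SUP (z, v) \<in> UNIV. (f z - f v)\<^sup>2) > 0"
proof (rule ccontr)
  assume "\<not> ?thesis"
  then have "(f z - f v)\<^sup>2 \<le> 0" for z v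
    using square_increment_le_Sup[OF assms(1), of z v] by linarith
  then have "\<exists>c. f = (\<lambda>_. c)" by (intro exI[of _ "f 0"]) (auto simp: fun_eq_iff)
  then obtain c where "f = (\<lambda>_. c)" ..
  moreover interpret prob_space M by fact
  have "law_variance M (\<lambda>_. c) = 0"
    by (simp add: law_variance_def prob_space)
  ultimately show False using assms(3) by simp
qed

lemma eigendecomposition_diagonal:
  fixes U :: "real^'d^'d::finite"
  shows "(U ** diag_matrix l ** transpose U) $ i $ i = (\<Sum>k\<in>UNIV. l k * (U $ i $ k)\<^sup>2)"
  by (simp add: matrix_matrix_mult_def diag_matrix_def transpose_def if_distrib
      power2_eq_square ac_simps cong: if_cong)

text \<open>
  Since \<open>e\<close> enumerates every index exactly once, the full score is the sum over all eigenvectors,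
  which is the \<open>i\<close>th diagonal entry of \<open>U \<Lambda> U\<^sup>T\<close>.
\<close>

lemma activity_score_full:
  assumes "eigenvalue_decomposition C U l e"
  shows "activity_score U l e i CARD('d::finite) = (C :: real^'d^'d) $ i $ i"
proof -
  have bij: "bij_betw e {1..CARD('d)} UNIV" and C: "C = U ** diag_matrix l ** transpose U"
    using assms by (auto simp: eigenvalue_decomposition_def)
  have "activity_score U l e i CARD('d) = (\<Sum>k\<in>UNIV. l k * (U $ i $ k)\<^sup>2)"
    unfolding activity_score_def by (rule sum.reindex_bij_betw[OF bij])
  then show ?thesis by (simp add: C eigendecomposition_diagonal)
qed

text \<open>
  Taking the mean of a conditional expectation removes the conditioning; the \<open>\<sigma>\<close>-algebra generated
  by \<open>Z\<close> is a sub-\<open>\<sigma>\<close>-algebra because \<open>Z\<close> is measurable.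
\<close>

lemma gas_matrix_diagonal:
  fixes V Z :: "'w \<Rightarrow> real^'d::finite"
  assumes "prob_space P" "Z \<in> measurable P borel" "gas_matrix_finite P V Z f"
  shows "gas_matrix P V Z f $ i $ i = (\<integral>w. (diff_quotient f (V w) (Z w) $ i)\<^sup>2 \<partial>P)"
proof -
  interpret prob_space P by fact
  let ?G = "vimage_algebra (space P) Z borel"
  have "subalgebra P ?G"
    using assms(2) by (auto simp: subalgebra_def sets_vimage_algebra2 measurable_def)
  then interpret finite_measure_subalgebra P ?G
    by unfold_locales
  show ?thesis
    using assms(3) unfolding gas_matrix_def gas_matrix_finite_def
    by (simp add: real_cond_exp_int(2) power2_eq_square)
qed

text \<open>
  Only the \<open>i\<close>th coordinate of \<open>V\<close> enters the increment, so the integral defining the Sobol' index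
  is an expectation over the independent copies \<open>V\<close> and \<open>Z\<close>.
\<close>

lemma upper_sobol_eq_expectation:
  fixes F :: "'d::finite \<Rightarrow> real \<Rightarrow> real" and V Z :: "'w \<Rightarrow> real^'d"
  assumes F: "\<And>i. distribution_function (F i)"
    and f [measurable]: "f \<in> borel_measurable borel"
    and P: "prob_space P"
    and indep: "prob_space.indep_var P borel V borel Z"
    and V: "distr P borel V = joint_law F"
    and Z: "distr P borel Z = joint_law F"
  shows "upper_sobol F f i = 1 / (2 * law_variance (joint_law F) f) *
    (\<integral>w. (f (Z w) - f (replace_coord i (V w $ i) (Z w)))\<^sup>2 \<partial>P)"
proof -
  interpret prob_space P by fact
  have [measurable]: "V \<in> borel_measurable P" "Z \<in> borel_measurable P"
    using indep by (auto simp: indep_var_rv1 indep_var_rv2)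
  interpret marginal: real_distribution "interval_measure (F i)"
    by (rule real_distribution_marginal[OF F])
  interpret law: prob_space "joint_law F"
    by (rule prob_space_joint_law[OF F])
  interpret law_pair: pair_sigma_finite "joint_law F" "joint_law F" ..
  have "joint_law F \<Otimes>\<^sub>M joint_law F = distr P (borel \<Otimes>\<^sub>M borel) (\<lambda>w. (V w, Z w))"
    using indep by (simp add: indep_var_distribution_eq V Z)
  then have joint: "joint_law F \<Otimes>\<^sub>M joint_law F = distr P (borel \<Otimes>\<^sub>M borel) (\<lambda>w. (Z w, V w))"
    by (subst law_pair.distr_pair_swap) (auto simp: distr_distr comp_def cong: distr_cong)
  \<comment> \<open>Project the second factor of the law of \<open>(Z, V)\<close> to its \<open>i\<close>th coordinate.\<close>
  have "joint_law F \<Otimes>\<^sub>M interval_measure (F i) =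
      distr (joint_law F) borel (\<lambda>z. z) \<Otimes>\<^sub>M distr (joint_law F) borel (\<lambda>v. v $ i)"
    by (simp add: distr_joint_law_component[OF F] distr_id2)
  also have "\<dots> = distr (joint_law F \<Otimes>\<^sub>M joint_law F) (borel \<Otimes>\<^sub>M borel) (\<lambda>(z, v). (z, v $ i))"
    by (rule pair_measure_distr)
      (auto simp: distr_joint_law_component[OF F] marginal.sigma_finite_measure_axioms)
  also have "\<dots> = distr P (borel \<Otimes>\<^sub>M borel) (\<lambda>w. (Z w, V w $ i))"
    unfolding joint by (subst distr_distr) (auto simp: comp_def)
  finally have law: "joint_law F \<Otimes>\<^sub>M interval_measure (F i) =
      distr P (borel \<Otimes>\<^sub>M borel) (\<lambda>w. (Z w, V w $ i))" .
  show ?thesis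
    unfolding upper_sobol_def law by (subst integral_distr) auto
qed

text \<open>
  Outside the cube only the supremum is available; inside it, \<open>\<bar>v\<^sub>i - z\<^sub>i\<bar> < b - a\<close> turns the
  difference quotient into a bound on the increment.
\<close>

lemma mean_square_increment_le:
  fixes V Z :: "'w \<Rightarrow> real^'d::finite"
  assumes bounded: "bounded (range f)"
    and f [measurable]: "f \<in> borel_measurable borel"
    and P: "prob_space P"
    and indep: "prob_space.indep_var P borel V borel Z"
    and V: "distr P borel V = M"
    and Z: "distr P borel Z = M"
    and fin: "integrable P (\<lambda>w. (diff_quotient f (V w) (Z w) $ i)\<^sup>2)"
    and cube: "measure M {z. \<forall>i. a < z $ i \<and> z $ i < b} = 1 - \<epsilon>"
    and ab: "a < b"
  shows "(\<integral>w. (f (Z w) - f (replace_coord i (V w $ i) (Z w)))\<^sup>2 \<partial>P) \<le>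
    (b - a)\<^sup>2 * ((\<integral>w. (diff_quotient f (V w) (Z w) $ i)\<^sup>2 \<partial>P) + kappa_const \<epsilon> a b f)"
proof -
  interpret prob_space P by fact
  let ?S = "SUP (z, v) \<in> UNIV. (f z - f v)\<^sup>2"
  let ?C = "{z :: real^'d. \<forall>i. a < z $ i \<and> z $ i < b}"
  let ?g = "\<lambda>w. (f (Z w) - f (replace_coord i (V w $ i) (Z w)))\<^sup>2"
  let ?q = "\<lambda>w. (diff_quotient f (V w) (Z w) $ i)\<^sup>2"
  have [measurable]: "V \<in> borel_measurable P" "Z \<in> borel_measurable P"
    using indep by (auto simp: indep_var_rv1 indep_var_rv2)
  have "?C = box (\<chi> i. a) (\<chi> i. b)" by (auto simp: mem_box_cart)
  then have C [measurable]: "?C \<in> sets borel" by simp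
  define A where "A = {w \<in> space P. V w \<in> ?C \<and> Z w \<in> ?C}"
  have A [measurable]: "A \<in> sets P" unfolding A_def by measurable
  have probA: "prob A = (1 - \<epsilon>)\<^sup>2"
  proof -
    have "A = (V -` ?C \<inter> space P) \<inter> (Z -` ?C \<inter> space P)" by (auto simp: A_def)
    then have "prob A = prob (V -` ?C \<inter> space P) * prob (Z -` ?C \<inter> space P)"
      using indep_varD[OF indep C C] by (simp add: vimage_Times Int_ac Int_left_commute)
    also have "prob (V -` ?C \<inter> space P) = 1 - \<epsilon>"
      using cube by (simp flip: V add: measure_distr)
    also have "prob (Z -` ?C \<inter> space P) = 1 - \<epsilon>"
      using cube by (simp flip: Z add: measure_distr)
    finally show ?thesis by (simp add: power2_eq_square)
  qed
  have g_le: "?g w \<le> ?S" for w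
    by (rule square_increment_le_Sup[OF bounded])
  have [measurable]: "(\<lambda>w. replace_coord i (V w $ i) (Z w)) \<in> borel_measurable P"
    using measurable_compose[OF _ borel_measurable_replace_coord, of "\<lambda>w. (Z w, V w $ i)" P i]
    by (simp add: measurable_Pair)
  have g_int: "integrable P ?g"
    using g_le by (intro integrable_const_bound[of _ ?S]) auto
  have pointwise: "?g w \<le> (b - a)\<^sup>2 * ?q w + ?S * indicator (space P - A) w" if "w \<in> space P" for w
  proof (cases "w \<in> A")
    case True
    then have "\<bar>V w $ i - Z w $ i\<bar> \<le> \<bar>b - a\<bar>"
      by (auto simp: A_def abs_if) (smt (verit))+
    then have "(V w $ i - Z w $ i)\<^sup>2 \<le> (b - a)\<^sup>2"
      by (simp only: abs_le_square_iff)
    then have "?q w * (V w $ i - Z w $ i)\<^sup>2 \<le> ?q w * (b - a)\<^sup>2"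
      by (rule mult_left_mono) simp
    moreover have "?g w = ?q w * (V w $ i - Z w $ i)\<^sup>2"
      by (simp flip: power_mult_distrib increment_eq_diff_quotient add: power2_commute)
    ultimately show ?thesis using True by (simp add: mult.commute)
  next
    case False
    then show ?thesis
      using that g_le[of w] by (simp add: add_increasing)
  qed
  have "(\<integral>w. ?g w \<partial>P) \<le> (\<integral>w. (b - a)\<^sup>2 * ?q w + ?S * indicator (space P - A) w \<partial>P)"
    using g_int fin pointwise by (intro integral_mono) (auto simp: less_top[symmetric])
  also have "\<dots> = (b - a)\<^sup>2 * (\<integral>w. ?q w \<partial>P) + ?S * prob (space P - A)"
    using fin by (subst Bochner_Integration.integral_add) (auto simp: less_top[symmetric] Int_absorb2)
  also have "prob (space P - A) = 2 * \<epsilon> - \<epsilon>\<^sup>2"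
    by (simp add: prob_compl probA power2_eq_square algebra_simps)
  also have "(b - a)\<^sup>2 * (\<integral>w. ?q w \<partial>P) + ?S * (2 * \<epsilon> - \<epsilon>\<^sup>2) =
      (b - a)\<^sup>2 * ((\<integral>w. ?q w \<partial>P) + kappa_const \<epsilon> a b f)"
    using ab by (simp add: kappa_const_def distrib_left)
  finally show ?thesis .
qed

theorem theorem3p4:
  fixes F :: "'d::finite \<Rightarrow> real \<Rightarrow> real"
    and f :: "real^'d \<Rightarrow> real"
    and P :: "'w measure"
    and V Z :: "'w \<Rightarrow> real^'d"
    and U :: "real^'d^'d"
    and l :: "'d \<Rightarrow> real"
    and e :: "nat \<Rightarrow> 'd"
    and \<epsilon> a b :: real
  assumes "\<And>i. distribution_function (F i)"
    and "continuous_on UNIV (joint_cdf F)"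
    and "bounded (range f)"
    and "f \<in> borel_measurable borel"
    and "integrable (joint_law F) (\<lambda>z. (f z)\<^sup>2)"
    and "continuous_second_partials f"
    and "law_variance (joint_law F) f > 0"
    and "prob_space P"
    and "prob_space.indep_var P borel V borel Z"
    and "distr P borel V = joint_law F"
    and "distr P borel Z = joint_law F"
    and "gas_matrix_finite P V Z f"
    and "eigenvalue_decomposition (gas_matrix P V Z f) U l e"
    and "0 < \<epsilon>" and "\<epsilon> < 1" and "a < b"
    and "measure (joint_law F) {z. \<forall>i. a < z $ i \<and> z $ i < b} = 1 - \<epsilon>"
  shows "kappa_const \<epsilon> a b f > 0 \<and>
    (\<forall>i. upper_sobol F f i \<le>
       (b - a)\<^sup>2 / 2 *
       ((activity_score U l e i CARD('d) + kappa_const \<epsilon> a b f) / law_variance (joint_law F) f))"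
proof (intro conjI allI)
  note F = assms(1) and var = assms(7) and indep = assms(9) and fin = assms(12)
  have "\<epsilon>\<^sup>2 < 2 * \<epsilon>"
    using assms(14,15) by (simp add: power2_eq_square)
  then show "kappa_const \<epsilon> a b f > 0"
    unfolding kappa_const_def
    using \<open>a < b\<close> Sup_square_increment_pos[OF assms(3) prob_space_joint_law[OF F] var]
    by (intro mult_pos_pos divide_pos_pos) auto
  fix i
  have Z_meas: "Z \<in> measurable P borel"
    using prob_space.indep_var_rv2[OF assms(8) indep] .
  have score: "activity_score U l e i CARD('d) = (\<integral>w. (diff_quotient f (V w) (Z w) $ i)\<^sup>2 \<partial>P)"
    using activity_score_full[OF assms(13)] gas_matrix_diagonal[OF assms(8) Z_meas fin] by simp
  have "integrable P (\<lambda>w. (diff_quotient f (V w) (Z w) $ i)\<^sup>2)"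
    using fin by (simp add: gas_matrix_finite_def power2_eq_square)
  then have "(\<integral>w. (f (Z w) - f (replace_coord i (V w $ i) (Z w)))\<^sup>2 \<partial>P) \<le>
      (b - a)\<^sup>2 * (activity_score U l e i CARD('d) + kappa_const \<epsilon> a b f)"
    unfolding score
    by (rule mean_square_increment_le[OF assms(3,4,8) indep assms(10,11) _ assms(17,16)])
  then show "upper_sobol F f i \<le> (b - a)\<^sup>2 / 2 *
      ((activity_score U l e i CARD('d) + kappa_const \<epsilon> a b f) / law_variance (joint_law F) f)"
    using var
    by (simp add: upper_sobol_eq_expectation[OF F assms(4,8) indep assms(10,11)] field_simps)
qed

end
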